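(* Let $n \geq 4$ and let $G = CS_{3,n-3}$ be the cycle-star graph with cycle length $k=3$ and $n-k \geq 1$ pendant vertices. Then $es(G) = n-1$.
   Context: For integers $k \geq 3$ and $n > k$, the cycle-star graph $CS_{k,n-k}$ is the simple graph on $n$ vertices consisting of a cycle of length $k$ together with $n-k$ additional vertices of degree one (leaves), all adjacent to the same single vertex of the cycle. For a simple graph $G$, a vertex $k$-labeling is a map $\phi: V(G) \to \{1,2,\ldots,k\}$; the weight of an edge $uv$ is $w_\phi(uv) = \phi(u)+\phi(v)$. The labeling is an edge irregular $k$-labeling if distinct edges have distinct weights. The edge irregularity strength $es(G)$ is the minimum $k$ for which $G$ admits an edge irregular $k$-labeling. *)

theory Defs
  imports "HOL-Library.Nat_Bijection"
begin

text \<open>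
  A simple graph is given by its vertex set and its set of edges, an edge being the
  two-element set of its endpoints.
\<close>

definition simple_graph :: "'a set \<Rightarrow> 'a set set \<Rightarrow> bool" where
  "simple_graph V E \<longleftrightarrow> finite V \<and> (\<forall>e\<in>E. e \<subseteq> V \<and> card e = 2)"

definition cycle_star :: "nat \<Rightarrow> nat \<Rightarrow> 'a set \<Rightarrow> 'a set set \<Rightarrow> bool" where
  "cycle_star k m V E \<longleftrightarrow> 3 \<le> k \<and> 1 \<le> m \<and>
     (\<exists>c L. inj_on c {..<k} \<and> finite L \<and> card L = m \<and> c ` {..<k} \<inter> L = {} \<and>
        V = c ` {..<k} \<union> L \<and>
        E = {{c i, c (Suc i mod k)} | i. i < k} \<union> {{c 0, x} | x. x \<in> L})"

text \<open>For an edge \<open>{u, v}\<close> with \<open>u \<noteq> v\<close> the following sum is \<open>\<phi> u + \<phi> v\<close>.\<close>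

definition edge_weight :: "('a \<Rightarrow> nat) \<Rightarrow> 'a set \<Rightarrow> nat" where
  "edge_weight \<phi> e = (\<Sum>v\<in>e. \<phi> v)"

definition edge_irregular_labeling ::
    "'a set \<Rightarrow> 'a set set \<Rightarrow> nat \<Rightarrow> ('a \<Rightarrow> nat) \<Rightarrow> bool" where
  "edge_irregular_labeling V E k \<phi> \<longleftrightarrow> \<phi> ` V \<subseteq> {1..k} \<and> inj_on (edge_weight \<phi>) E"

definition edge_irregularity_strength :: "'a set \<Rightarrow> 'a set set \<Rightarrow> nat" where
  "edge_irregularity_strength V E = (LEAST k. \<exists>\<phi>. edge_irregular_labeling V E k \<phi>)"

lemma edge_weight_doubleton: "u \<noteq> v \<Longrightarrow> edge_weight \<phi> {u, v} = \<phi> u + \<phi> v"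
  by (simp add: edge_weight_def)

text \<open>The minimum is taken over a nonempty set: label the vertices by distinct powers of 2.\<close>

lemma edge_irregular_labeling_exists:
  assumes "simple_graph V E"
  shows "\<exists>k \<phi>. edge_irregular_labeling V E k \<phi>"
proof -
  have fin: "finite V" and sub: "\<And>e. e \<in> E \<Longrightarrow> e \<subseteq> V"
    using assms by (auto simp: simple_graph_def)
  obtain f :: "'a \<Rightarrow> nat" where f: "inj_on f V"
    using finite_imp_inj_to_nat_seg[OF fin] by blast
  define \<phi> where "\<phi> v = (2::nat) ^ f v" for v
  have w: "edge_weight \<phi> e = set_encode (f ` e)" if "e \<in> E" for e
    using inj_on_subset[OF f sub[OF that]]
    by (simp add: edge_weight_def set_encode_def sum.reindex \<phi>_def)
  have "inj_on (edge_weight \<phi>) E"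
  proof (rule inj_onI)
    fix d e assume d: "d \<in> E" and e: "e \<in> E" and "edge_weight \<phi> d = edge_weight \<phi> e"
    then have "set_encode (f ` d) = set_encode (f ` e)" by (simp add: w)
    moreover have "finite (f ` d)" "finite (f ` e)"
      using sub[OF d] sub[OF e] fin by (auto intro: finite_subset)
    ultimately have "f ` d = f ` e" by (simp add: set_encode_eq)
    then show "d = e" using inj_on_image_eq_iff[OF f sub[OF d] sub[OF e]] by simp
  qed
  moreover have "\<phi> ` V \<subseteq> {1..Max (\<phi> ` V)}" using fin by (auto simp: \<phi>_def)
  ultimately show ?thesis unfolding edge_irregular_labeling_def by blast
qed

lemma cycle_star_simple_graph:
  assumes "cycle_star k m V E"
  shows "simple_graph V E"
proof -
  obtain c L where *: "3 \<le> k" "inj_on c {..<k}" "finite L" "c ` {..<k} \<inter> L = {}"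
    "V = c ` {..<k} \<union> L"
    "E = {{c i, c (Suc i mod k)} | i. i < k} \<union> {{c 0, x} | x. x \<in> L}"
    using assms unfolding cycle_star_def by blast
  have c0: "c 0 \<in> c ` {..<k}" using *(1) by auto
  have ne: "c i \<noteq> c (Suc i mod k)" if "i < k" for i
  proof -
    have "Suc i mod k < k" "Suc i mod k \<noteq> i" using that *(1)
      by (auto simp: mod_Suc)
    then show ?thesis using that *(2) by (metis inj_onD lessThan_iff)
  qed
  have "e \<subseteq> V \<and> card e = 2" if eE: "e \<in> E" for e
  proof -
    consider i where "i < k" "e = {c i, c (Suc i mod k)}" | x where "x \<in> L" "e = {c 0, x}"
      using eE[unfolded *(6)] by blast
    then show ?thesis
    proof cases
      case 1
      then show ?thesis using ne *(1,5) by auto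
    next
      case 2
      then have "c 0 \<noteq> x" using c0 *(4) by blast
      then show ?thesis using 2 c0 *(5) by auto
    qed
  qed
  then show ?thesis using *(3,5) by (simp add: simple_graph_def)
qed

lemma cycle_star_card:
  assumes "cycle_star k m V E"
  shows "card V = k + m"
proof -
  obtain c L where *: "inj_on c {..<k}" "finite L" "card L = m" "c ` {..<k} \<inter> L = {}"
    "V = c ` {..<k} \<union> L"
    using assms unfolding cycle_star_def by blast
  then show ?thesis by (simp add: card_Un_disjoint card_image)
qed

lemma cycle_star_exists:
  assumes "3 \<le> k" "1 \<le> m"
  shows "\<exists>(V :: nat set) E. cycle_star k m V E"
proof -
  have "inj_on id {..<k} \<and> finite {k..<k + m} \<and> card {k..<k + m} = m \<and>
      id ` {..<k} \<inter> {k..<k + m} = {}"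
    by auto
  then show ?thesis using assms unfolding cycle_star_def by blast
qed

end

theory Submission
  imports Defs
begin

text \<open>
  The vertex \<open>a\<close> carrying the leaves is adjacent to all other \<open>n - 1\<close> vertices, and these must
  receive distinct labels, so \<open>n - 1\<close> labels are necessary. Conversely, give the neighbours of
  \<open>a\<close> the labels \<open>1, \<dots>, n - 1\<close>, with \<open>1\<close> and \<open>2\<close> on the triangle, and give \<open>a\<close> itself the
  label \<open>n - 1\<close>: the edges at \<open>a\<close> have the weights \<open>n, \<dots>, 2 n - 2\<close>, and the remaining edge has
  weight \<open>3 < n\<close>.
\<close>

text \<open>The edges from \<open>a\<close> to \<open>N\<close> share the summand
  \<open>\<phi> a\<close>, so distinct weights force \<open>\<phi>\<close> to be injective on
  \<open>N\<close>, which therefore embeds into \<open>{1..k}\<close>.\<close>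

lemma edge_irregular_labeling_degree_le:
  assumes lab: "edge_irregular_labeling V E k \<phi>"
    and N: "N \<subseteq> V" "a \<notin> N" "\<And>x. x \<in> N \<Longrightarrow> {a, x} \<in> E"
  shows "card N \<le> k"
proof -
  have "inj_on \<phi> N"
  proof (rule inj_onI)
    fix x y assume xy: "x \<in> N" "y \<in> N" "\<phi> x = \<phi> y"
    then have "a \<noteq> x" "a \<noteq> y" using N(2) by auto
    then have "edge_weight \<phi> {a, x} = edge_weight \<phi> {a, y}"
      using xy(3) by (simp add: edge_weight_doubleton)
    then have "{a, x} = {a, y}"
      using lab N(3) xy(1,2) unfolding edge_irregular_labeling_def by (metis inj_onD)
    then show "x = y" by (auto simp: doubleton_eq_iff)
  qed
  moreover have "\<phi> ` N \<subseteq> {1..k}"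
    using lab N(1) unfolding edge_irregular_labeling_def by blast
  ultimately have "card N \<le> card {1..k}" by (rule card_inj_on_le) simp
  then show ?thesis by simp
qed

text \<open>Trades indices modulo 3 for named vertices and splits the edges into the star at
  \<open>a\<close> and the one edge \<open>{b, d}\<close> avoiding \<open>a\<close>; both bounds
  start from this form.\<close>

lemma cycle_star_3E:
  assumes "cycle_star 3 m V E"
  obtains a b d L where "a \<noteq> b" "a \<noteq> d" "b \<noteq> d" "{a, b, d} \<inter> L = {}" "finite L" "card L = m"
    "V = {a, b, d} \<union> L" "E = insert {b, d} ((\<lambda>x. {a, x}) ` ({b, d} \<union> L))"
proof -
  obtain c L where c: "inj_on c {..<3}" "finite L" "card L = m" "c ` {..<3} \<inter> L = {}"
    "V = c ` {..<3} \<union> L"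
    and E: "E = {{c i, c (Suc i mod 3)} | i. i < 3} \<union> {{c 0, x} | x. x \<in> L}"
    using assms unfolding cycle_star_def by blast
  have three: "{..<3} = {0, 1, 2 :: nat}" by auto
  have "{{c i, c (Suc i mod 3)} | i. i < 3} = (\<lambda>i. {c i, c (Suc i mod 3)}) ` {..<3}"
    by auto
  \<comment> \<open>The index 2 wraps around to 0, which closes the triangle.\<close>
  also have "\<dots> = {{c 0, c 1}, {c 1, c 2}, {c 0, c 2}}"
    by (simp add: three insert_commute numeral_2_eq_2)
  finally have "E = insert {c 1, c 2} ((\<lambda>x. {c 0, x}) ` ({c 1, c 2} \<union> L))"
    unfolding E by auto
  then show thesis
    using c that[of "c 0" "c 1" "c 2" L] by (simp add: three)
qed

lemma cycle_star_3_labeling_exists: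
  assumes "n \<ge> 4" "cycle_star 3 (n - 3) V E"
  shows "\<exists>\<phi>. edge_irregular_labeling V E (n - 1) \<phi>"
proof -
  from assms(2) obtain a b d L where
    dist: "a \<noteq> b" "a \<noteq> d" "b \<noteq> d" "{a, b, d} \<inter> L = {}" and L: "finite L" "card L = n - 3"
    and V: "V = {a, b, d} \<union> L" and E: "E = insert {b, d} ((\<lambda>x. {a, x}) ` ({b, d} \<union> L))"
    by (rule cycle_star_3E)
  \<comment> \<open>The leaves take exactly the labels that \<open>b\<close> and \<open>d\<close>
    leave free.\<close>
  obtain g where "bij_betw g L {3..<n}"
    using L finite_same_card_bij[of L "{3..<n}"] by auto
  then have g: "inj_on g L" "\<And>x. x \<in> L \<Longrightarrow> 3 \<le> g x \<and> g x < n"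
    by (auto simp: bij_betw_def)
  \<comment> \<open>Some leaf also has the label \<open>n - 1\<close> of \<open>a\<close>. This is
    harmless: only labels within the neighbourhood of \<open>a\<close> must differ.\<close>
  define \<phi> where "\<phi> = g(a := n - 1, b := 1, d := 2)"
  have \<phi>: "\<phi> a = n - 1" "\<phi> b = 1" "\<phi> d = 2" "\<And>x. x \<in> L \<Longrightarrow> \<phi> x = g x"
    using dist by (auto simp: \<phi>_def)
  have "\<phi> ` V \<subseteq> {1..n - 1}"
    using assms(1) g(2) \<phi> by (fastforce simp: V)
  moreover have "inj_on (edge_weight \<phi>) E"
  proof -
    have inj: "inj_on \<phi> ({b, d} \<union> L)"
      using g \<phi> by (fastforce simp: inj_on_def)
    have star: "edge_weight \<phi> {a, x} = n - 1 + \<phi> x" if "x \<in> {b, d} \<union> L" for x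
      using that dist \<phi>(1) by (subst edge_weight_doubleton) auto
    have pos: "\<phi> x \<ge> 1" if "x \<in> {b, d} \<union> L" for x
      using that g(2) \<phi> by fastforce
    have "edge_weight \<phi> {b, d} = 3"
      using dist(3) \<phi> by (simp add: edge_weight_doubleton)
    \<comment> \<open>Star weights are at least \<open>n\<close>, hence at least 4.\<close>
    moreover have "n - 1 + \<phi> x \<noteq> 3" if "x \<in> {b, d} \<union> L" for x
      using pos[OF that] assms(1) by simp
    ultimately have "edge_weight \<phi> {b, d} \<noteq> edge_weight \<phi> {a, x}" if "x \<in> {b, d} \<union> L" for x
      using that star[OF that] by metis
    then have "edge_weight \<phi> {b, d} \<notin> (\<lambda>x. edge_weight \<phi> {a, x}) ` ({b, d} \<union> L)"
      by blast
    moreover have "inj_on (edge_weight \<phi>) ((\<lambda>x. {a, x}) ` ({b, d} \<union> L))"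
    proof (intro inj_on_imageI inj_onI)
      fix x y assume xy: "x \<in> {b, d} \<union> L" "y \<in> {b, d} \<union> L"
        and "(edge_weight \<phi> \<circ> (\<lambda>x. {a, x})) x = (edge_weight \<phi> \<circ> (\<lambda>x. {a, x})) y"
      then have "\<phi> x = \<phi> y" using star[OF xy(1)] star[OF xy(2)] by simp
      then show "x = y" using inj xy by (simp only: inj_on_eq_iff)
    qed
    ultimately show ?thesis
      unfolding E inj_on_insert by blast
  qed
  ultimately show ?thesis unfolding edge_irregular_labeling_def by blast
qed

theorem theorem3p2:
  fixes n :: nat and V :: "'a set" and E :: "'a set set"
  assumes "n \<ge> 4"
    and "cycle_star 3 (n - 3) V E"
  shows "edge_irregularity_strength V E = n - 1"
  unfolding edge_irregularity_strength_def
proof (rule Least_equality)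
  show "\<exists>\<phi>. edge_irregular_labeling V E (n - 1) \<phi>"
    using assms by (rule cycle_star_3_labeling_exists)
next
  fix k assume "\<exists>\<phi>. edge_irregular_labeling V E k \<phi>"
  then obtain \<phi> where lab: "edge_irregular_labeling V E k \<phi>" by blast
  from assms(2) obtain a b d L where
    dist: "a \<noteq> b" "a \<noteq> d" "b \<noteq> d" "{a, b, d} \<inter> L = {}" and L: "finite L" "card L = n - 3"
    and V: "V = {a, b, d} \<union> L" and E: "E = insert {b, d} ((\<lambda>x. {a, x}) ` ({b, d} \<union> L))"
    by (rule cycle_star_3E)
  \<comment> \<open>The degree bound is applied to the whole neighbourhood of
    \<open>a\<close>.\<close>
  have "card ({b, d} \<union> L) \<le> k"
    using lab by (rule edge_irregular_labeling_degree_le[where a = a]) (use dist V E in auto)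
  moreover have "card ({b, d} \<union> L) = n - 1"
    using dist L assms(1) by simp
  ultimately show "n - 1 \<le> k" by simp
qed

end
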